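(* Let $n\ge 1$ and let $Q\subset\ell_\infty^n$ be a non-empty subset. Then $Q$ (with the induced metric) is injective if and only if there exist, for each $i=1,\ldots,n$, functions $\underline{r}_i,\bar{r}_i$ on $\ell_\infty^{n-1}$ such that each $\underline{r}_i$ is either a $1$-Lipschitz map $\ell_\infty^{n-1}\to\mathbb{R}$ or the constant $-\infty$, each $\bar{r}_i$ is either a $1$-Lipschitz map $\ell_\infty^{n-1}\to\mathbb{R}$ or the constant $+\infty$, $\underline{r}_i\le\bar{r}_i$ at every point of $\ell_\infty^{n-1}$ for every $i$, and $$Q=\{x\in\ell_\infty^n \mid \underline{r}_i(\widehat{x}_i)\le x_i\le \bar{r}_i(\widehat{x}_i)\ \text{for } i=1,\ldots,n\}.$$ (Choosing a constant $\mp\infty$ for a bound means that the corresponding inequality is dropped, so $Q$ is the solution set of at most $2n$ inequalities.)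
   Context: $\ell_\infty^n$ denotes $\mathbb{R}^n$ with the metric induced by the maximum norm $\|\cdot\|$; $\ell_\infty^0$ is the one-point space $\{0\}$. For $x\in\ell_\infty^n$, $\widehat{x}_i:=(x_1,\ldots,x_{i-1},x_{i+1},\ldots,x_n)\in\ell_\infty^{n-1}$ is $x$ with the $i$-th coordinate omitted (for $n=1$, $\widehat{x}_1=0\in\ell_\infty^0$). A metric space $X$ is injective if for every metric space $B$, every subset $A\subset B$ and every $1$-Lipschitz map $\Phi\colon A\to X$ there is a $1$-Lipschitz map $\overline{\Phi}\colon B\to X$ extending $\Phi$ (the case $A=\emptyset\ne B$ is allowed, so injective spaces are non-empty). *)

theory Defs
  imports "HOL-Analysis.Analysis"
begin

text \<open>Points of \<open>\<real>\<^sup>n\<close> are the functions on \<open>{1..n}\<close>, extended by \<open>undefined\<close>,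
  so that \<open>n\<close> may be any natural number; for \<open>n = 0\<close> there is exactly one point.\<close>

definition linf_dist :: "nat \<Rightarrow> (nat \<Rightarrow> real) \<Rightarrow> (nat \<Rightarrow> real) \<Rightarrow> real" where
  "linf_dist n x y = (if n = 0 then 0 else MAX i\<in>{1..n}. \<bar>x i - y i\<bar>)"

definition linf :: "nat \<Rightarrow> (nat \<Rightarrow> real) metric" where
  "linf n = metric ({1..n} \<rightarrow>\<^sub>E UNIV, linf_dist n)"

lemma linf_dist_le_iff:
  assumes "0 \<le> c"
  shows "linf_dist n x y \<le> c \<longleftrightarrow> (\<forall>i\<in>{1..n}. \<bar>x i - y i\<bar> \<le> c)"
  using assms by (cases "n = 0") (auto simp: linf_dist_def)

lemma linf_dist_nonneg: "0 \<le> linf_dist n x y"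
proof (cases "n = 0")
  case False
  then have "\<bar>x 1 - y 1\<bar> \<le> linf_dist n x y"
    by (auto simp: linf_dist_def intro!: Max_ge)
  then show ?thesis by linarith
qed (simp add: linf_dist_def)

lemma Metric_space_linf: "Metric_space ({1..n} \<rightarrow>\<^sub>E UNIV) (linf_dist n)"
proof
  fix x y z :: "nat \<Rightarrow> real"
  show "0 \<le> linf_dist n x y" by (rule linf_dist_nonneg)
  show "linf_dist n x y = linf_dist n y x"
    by (simp add: linf_dist_def abs_minus_commute)
  show "linf_dist n x y = 0 \<longleftrightarrow> x = y"
    if "x \<in> {1..n} \<rightarrow>\<^sub>E UNIV" "y \<in> {1..n} \<rightarrow>\<^sub>E UNIV"
  proof -
    have "linf_dist n x y = 0 \<longleftrightarrow> (\<forall>i\<in>{1..n}. x i = y i)"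
      using linf_dist_le_iff[of 0 n x y] linf_dist_nonneg[of n x y] by auto
    then show ?thesis using PiE_ext[OF that] by auto
  qed
  show "linf_dist n x z \<le> linf_dist n x y + linf_dist n y z"
  proof (subst linf_dist_le_iff)
    show "\<forall>i\<in>{1..n}. \<bar>x i - z i\<bar> \<le> linf_dist n x y + linf_dist n y z"
    proof
      fix i assume "i \<in> {1..n}"
      then have "\<bar>x i - y i\<bar> \<le> linf_dist n x y" "\<bar>y i - z i\<bar> \<le> linf_dist n y z"
        using linf_dist_le_iff[OF linf_dist_nonneg] by blast+
      then show "\<bar>x i - z i\<bar> \<le> linf_dist n x y + linf_dist n y z" by linarith
    qed
  qed (simp add: linf_dist_nonneg)
qed

lemma mspace_linf [simp]: "mspace (linf n) = {1..n} \<rightarrow>\<^sub>E UNIV"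
  and mdist_linf [simp]: "mdist (linf n) = linf_dist n"
  unfolding linf_def
  by (rule Metric_space.mspace_metric[OF Metric_space_linf])
    (rule Metric_space.mdist_metric[OF Metric_space_linf])

definition omit :: "nat \<Rightarrow> nat \<Rightarrow> (nat \<Rightarrow> real) \<Rightarrow> (nat \<Rightarrow> real)" where
  "omit n i x = (\<lambda>j\<in>{1..n-1}. if j < i then x j else x (Suc j))"

definition one_Lipschitz_map :: "'a metric \<Rightarrow> 'b metric \<Rightarrow> ('a \<Rightarrow> 'b) \<Rightarrow> bool" where
  "one_Lipschitz_map X Y f \<longleftrightarrow>
     f \<in> mspace X \<rightarrow> mspace Y \<and>
     (\<forall>x\<in>mspace X. \<forall>y\<in>mspace X. mdist Y (f x) (f y) \<le> mdist X x y)"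

text \<open>Injectivity quantifies over all metric spaces \<open>B\<close>. A HOL formula cannot quantify over
  types, so the type \<open>'b\<close> of the points of \<open>B\<close> is a parameter; all metric spaces carried by
  arbitrary (possibly empty) subsets of \<open>'b\<close> are considered. A space is injective if it is so
  for every \<open>'b\<close>.\<close>

definition injective_metric :: "'b itself \<Rightarrow> 'a metric \<Rightarrow> bool" where
  "injective_metric (_ :: 'b itself) X \<longleftrightarrow>
     (\<forall>(B :: 'b metric) A \<Phi>.
        A \<subseteq> mspace B \<and> one_Lipschitz_map (submetric B A) X \<Phi> \<longrightarrow>
        (\<exists>\<Psi>. one_Lipschitz_map B X \<Psi> \<and> (\<forall>a\<in>A. \<Psi> a = \<Phi> a)))"

text \<open>\<open>bound_function m c r\<close>: on \<open>linf m\<close>, \<open>r\<close> is either a real-valued 1-Lipschitz map or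
  the constant \<open>c\<close>, which is used with \<open>c = -\<infinity>\<close> and \<open>c = \<infinity>\<close>.\<close>

definition bound_function :: "nat \<Rightarrow> ereal \<Rightarrow> ((nat \<Rightarrow> real) \<Rightarrow> ereal) \<Rightarrow> bool" where
  "bound_function m c r \<longleftrightarrow>
     (\<exists>f. one_Lipschitz_map (linf m) euclidean_metric f \<and>
          (\<forall>y\<in>mspace (linf m). r y = ereal (f y))) \<or>
     (\<forall>y\<in>mspace (linf m). r y = c)"

definition Lipschitz_bounded_form :: "nat \<Rightarrow> (nat \<Rightarrow> real) set \<Rightarrow> bool" where
  "Lipschitz_bounded_form n Q \<longleftrightarrow>
     (\<exists>rlo rup :: nat \<Rightarrow> (nat \<Rightarrow> real) \<Rightarrow> ereal.
        (\<forall>i\<in>{1..n}. bound_function (n - 1) (- \<infinity>) (rlo i) \<and>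
                    bound_function (n - 1) \<infinity> (rup i) \<and>
                    (\<forall>y\<in>mspace (linf (n - 1)). rlo i y \<le> rup i y)) \<and>
        Q = {x \<in> mspace (linf n). \<forall>i\<in>{1..n}.
               rlo i (omit n i x) \<le> ereal (x i) \<and> ereal (x i) \<le> rup i (omit n i x)})"

end

theory Submission
  imports Defs
begin

text \<open>Both conditions are equivalent to \<open>Q\<close> being a 1-Lipschitz retract of \<open>\<real>\<^sup>n\<close> with the maximum
  norm. If \<open>Q\<close> is given by inequalities, then it is the fixed point set of the map \<open>T\<close> that clamps
  each \<open>x\<^sub>i\<close> to the interval prescribed by the other coordinates. Such a \<open>T\<close> is 1-Lipschitz, and the
  approximate solutions \<open>w\<close> of \<open>w = (1 - e) T w + e x\<close> are 1-Lipschitz in \<open>x\<close> and agree with \<open>x\<close> on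
  \<open>Q\<close>; a pointwise cluster point as \<open>e \<rightarrow> 0\<close>, which exists by Tychonoff's theorem, is a retraction
  onto \<open>Q\<close>. Composing it with coordinatewise McShane extensions gives injectivity. Conversely,
  a retraction moves each \<open>x\<close> outside \<open>Q\<close> to a point \<open>z\<close> at least as close to every point of \<open>Q\<close>,
  and this forces \<open>x\<close> to violate a Lipschitz bound in a coordinate realising the distance
  from \<open>x\<close> to \<open>z\<close>.\<close>

section \<open>Coordinates and distances\<close>

lemma abs_coord_le_linf_dist:
  assumes "i \<in> {1..n}"
  shows "\<bar>x i - y i\<bar> \<le> linf_dist n x y"
  using assms linf_dist_le_iff[OF linf_dist_nonneg] by blast

lemma linf_dist_leI:
  assumes "0 \<le> c" "\<And>i. i \<in> {1..n} \<Longrightarrow> \<bar>x i - y i\<bar> \<le> c"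
  shows "linf_dist n x y \<le> c"
  using assms by (simp add: linf_dist_le_iff)

lemma linf_dist_commute: "linf_dist n x y = linf_dist n y x"
  by (simp add: linf_dist_def abs_minus_commute)

lemma linf_dist_triangle: "linf_dist n x z \<le> linf_dist n x y + linf_dist n y z"
proof (rule linf_dist_leI)
  show "\<bar>x i - z i\<bar> \<le> linf_dist n x y + linf_dist n y z" if "i \<in> {1..n}" for i
    using abs_coord_le_linf_dist[OF that, of x y] abs_coord_le_linf_dist[OF that, of y z] by linarith
qed (simp add: linf_dist_nonneg)

lemma linf_dist_attained:
  assumes "n \<ge> 1"
  obtains i where "i \<in> {1..n}" "linf_dist n x y = \<bar>x i - y i\<bar>"
proof -
  have "Max ((\<lambda>i. \<bar>x i - y i\<bar>) ` {1..n}) \<in> (\<lambda>i. \<bar>x i - y i\<bar>) ` {1..n}"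
    using assms by (intro Max_in) auto
  then obtain i where "i \<in> {1..n}" "Max ((\<lambda>i. \<bar>x i - y i\<bar>) ` {1..n}) = \<bar>x i - y i\<bar>"
    by blast
  then show ?thesis
    using assms that[of i] by (simp add: linf_dist_def)
qed

lemma omit_in_mspace [simp]: "omit n i x \<in> {1..n - 1} \<rightarrow>\<^sub>E UNIV"
  by (simp add: omit_def)

text \<open>Coordinates below \<open>i\<close> keep their index under \<open>omit n i\<close> and
  those above \<open>i\<close> move down by one, so together they run through all coordinates other
  than \<open>i\<close>. This splitting turns Lipschitz estimates in the remaining coordinates into
  estimates in the full maximum norm, and back.\<close>

lemma linf_dist_omit:
  assumes i: "i \<in> {1..n}"
  shows "linf_dist n x y = max \<bar>x i - y i\<bar> (linf_dist (n - 1) (omit n i x) (omit n i y))"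
    (is "_ = max _ ?D")
proof (rule antisym)
  show "linf_dist n x y \<le> max \<bar>x i - y i\<bar> ?D"
  proof (rule linf_dist_leI)
    fix j assume j: "j \<in> {1..n}"
    consider "j = i" | "j < i" | "j > i" by linarith
    then show "\<bar>x j - y j\<bar> \<le> max \<bar>x i - y i\<bar> ?D"
    proof cases
      case 2
      then have "j \<in> {1..n - 1}" using i j by auto
      then have "\<bar>omit n i x j - omit n i y j\<bar> \<le> ?D" by (rule abs_coord_le_linf_dist)
      moreover have "omit n i u j = u j" for u
        using 2 \<open>j \<in> {1..n - 1}\<close> by (simp add: omit_def)
      ultimately show ?thesis by simp
    next
      case 3
      then have j': "j - 1 \<in> {1..n - 1}" "Suc (j - 1) = j" "\<not> j - 1 < i" using i j by auto
      then have "\<bar>omit n i x (j - 1) - omit n i y (j - 1)\<bar> \<le> ?D"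
        by (intro abs_coord_le_linf_dist)
      moreover have "omit n i u (j - 1) = u j" for u
        using j' by (simp add: omit_def)
      ultimately show ?thesis by simp
    qed simp
  qed (simp add: linf_dist_nonneg)
  have "?D \<le> linf_dist n x y"
  proof (rule linf_dist_leI)
    show "\<bar>omit n i x j - omit n i y j\<bar> \<le> linf_dist n x y" if "j \<in> {1..n - 1}" for j
      using that abs_coord_le_linf_dist[of j n x y] abs_coord_le_linf_dist[of "Suc j" n x y]
      by (auto simp: omit_def)
  qed (simp add: linf_dist_nonneg)
  then show "max \<bar>x i - y i\<bar> ?D \<le> linf_dist n x y"
    using abs_coord_le_linf_dist[OF i] by simp
qed

section \<open>Nonexpansive retractions onto fixed point sets\<close>

text \<open>Tychonoff: the sequence stays in a product of compact intervals and so has a cluster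
  point there. The index type may be uncountable, so no convergent subsequence is claimed; closeness
  on finite sets of indices, infinitely often, is all that is used later.\<close>

lemma pointwise_bounded_cluster_function:
  fixes Z :: "nat \<Rightarrow> 's \<Rightarrow> real"
  assumes bd: "\<And>k s. \<bar>Z k s\<bar> \<le> B s"
  obtains r where "\<And>S e k0. \<lbrakk>finite S; 0 < e\<rbrakk> \<Longrightarrow> \<exists>k\<ge>k0. \<forall>s\<in>S. \<bar>Z k s - r s\<bar> < e"
proof -
  define K where "K = Pi\<^sub>E UNIV (\<lambda>s. {- B s..B s})"
  have "compactin (product_topology (\<lambda>_. euclidean) UNIV) K"
    unfolding K_def compactin_PiE by simp
  then have "compact K"
    by (simp add: euclidean_product_topology)
  moreover have "- B s \<le> Z k s \<and> Z k s \<le> B s" for k s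
    using bd[of k s] by linarith
  then have "eventually (\<lambda>f. f \<in> K) (filtermap Z sequentially)"
    unfolding eventually_filtermap K_def by (intro always_eventually allI PiE_I) auto
  moreover have "filtermap Z sequentially \<noteq> bot"
    by (simp add: filtermap_bot_iff)
  ultimately obtain r where r: "inf (nhds r) (filtermap Z sequentially) \<noteq> bot"
    unfolding compact_filter by blast
  have "\<exists>k\<ge>k0. \<forall>s\<in>S. \<bar>Z k s - r s\<bar> < e" if "finite S" "0 < e" for S e k0
  proof (rule ccontr)
    assume contr: "\<not> ?thesis"
    \<comment> \<open>\<open>U\<close> is a basic neighbourhood of \<open>r\<close> in the product
      topology. If the claim failed, the sequence would avoid \<open>U\<close> from
      \<open>k0\<close> on, against \<open>r\<close> being a cluster point.\<close>
    define U where "U = {f. \<forall>s\<in>S. f s \<in> ball (r s) e}"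
    have "open U"
      unfolding U_def using product_topology_basis'[of S "\<lambda>s. ball (r s) e" "\<lambda>s. s"] that by simp
    then have "eventually (\<lambda>f. f \<in> U) (nhds r)"
      using that by (intro eventually_nhds_in_open) (auto simp: U_def)
    moreover have "eventually (\<lambda>f. f \<notin> U) (filtermap Z sequentially)"
      unfolding eventually_filtermap eventually_sequentially
      using contr by (auto simp: U_def dist_real_def abs_minus_commute)
    ultimately have "eventually (\<lambda>_. False) (inf (nhds r) (filtermap Z sequentially))"
      unfolding eventually_inf by blast
    with r show False by (simp add: eventually_False)
  qed
  then show ?thesis by (rule that)
qed

definition linf_retraction :: "nat \<Rightarrow> (nat \<Rightarrow> real) set \<Rightarrow> ((nat \<Rightarrow> real) \<Rightarrow> nat \<Rightarrow> real) \<Rightarrow> bool" where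
  "linf_retraction n Q R \<longleftrightarrow>
     one_Lipschitz_map (linf n) (submetric (linf n) Q) R \<and> (\<forall>x\<in>Q. R x = x)"

lemma linf_retractionD:
  assumes "linf_retraction n Q R"
  shows "x \<in> {1..n} \<rightarrow>\<^sub>E UNIV \<Longrightarrow> R x \<in> Q"
    and "\<lbrakk>x \<in> {1..n} \<rightarrow>\<^sub>E UNIV; y \<in> {1..n} \<rightarrow>\<^sub>E UNIV\<rbrakk> \<Longrightarrow> linf_dist n (R x) (R y) \<le> linf_dist n x y"
    and "x \<in> Q \<Longrightarrow> R x = x"
  using assms by (auto simp: linf_retraction_def one_Lipschitz_map_def)

section \<open>Approximate fixed points by averaged iteration\<close>

locale nonexpansive_self_map =
  fixes n :: nat and T :: "(nat \<Rightarrow> real) \<Rightarrow> nat \<Rightarrow> real" and q :: "nat \<Rightarrow> real"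
  assumes T_in: "\<And>x. x \<in> {1..n} \<rightarrow>\<^sub>E UNIV \<Longrightarrow> T x \<in> {1..n} \<rightarrow>\<^sub>E UNIV"
    and T_Lip: "\<And>x y. \<lbrakk>x \<in> {1..n} \<rightarrow>\<^sub>E UNIV; y \<in> {1..n} \<rightarrow>\<^sub>E UNIV\<rbrakk>
      \<Longrightarrow> linf_dist n (T x) (T y) \<le> linf_dist n x y"
    and q_in: "q \<in> {1..n} \<rightarrow>\<^sub>E UNIV" and T_q: "T q = q"
begin

definition averaged_step :: "real \<Rightarrow> (nat \<Rightarrow> real) \<Rightarrow> (nat \<Rightarrow> real) \<Rightarrow> nat \<Rightarrow> real" where
  "averaged_step e x w = (\<lambda>i\<in>{1..n}. (1 - e) * T w i + e * x i)"

text \<open>For \<open>0 < e\<close> and \<open>e \<le> 1\<close>, \<open>averaged_step e x\<close>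
  contracts distances by the factor \<open>1 - e\<close>. A finite number of steps of its Banach
  iteration replaces the limit, since approximate fixed points are enough. Starting at
  \<open>x\<close> itself makes the iterates 1-Lipschitz in \<open>x\<close>.\<close>

definition iter :: "real \<Rightarrow> nat \<Rightarrow> (nat \<Rightarrow> real) \<Rightarrow> nat \<Rightarrow> real" where
  "iter e m x = (averaged_step e x ^^ m) x"

lemma iter_0 [simp]: "iter e 0 x = x"
  by (simp add: iter_def)

lemma iter_Suc: "iter e (Suc m) x = averaged_step e x (iter e m x)"
  by (simp add: iter_def)

lemma iter_in: "x \<in> {1..n} \<rightarrow>\<^sub>E UNIV \<Longrightarrow> iter e m x \<in> {1..n} \<rightarrow>\<^sub>E UNIV"
  by (cases m) (auto simp: iter_Suc averaged_step_def)

lemma averaged_step_dist: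
  assumes e: "0 \<le> e" "e \<le> 1" and "v \<in> {1..n} \<rightarrow>\<^sub>E UNIV" "w \<in> {1..n} \<rightarrow>\<^sub>E UNIV"
  shows "linf_dist n (averaged_step e x v) (averaged_step e y w)
    \<le> (1 - e) * linf_dist n v w + e * linf_dist n x y"
proof (rule linf_dist_leI)
  show "0 \<le> (1 - e) * linf_dist n v w + e * linf_dist n x y"
    using e by (simp add: linf_dist_nonneg)
  fix i assume i: "i \<in> {1..n}"
  have 1: "\<bar>T v i - T w i\<bar> \<le> linf_dist n v w"
    using abs_coord_le_linf_dist[OF i] T_Lip[OF assms(3,4)] by (rule order_trans)
  have "averaged_step e x v i - averaged_step e y w i
    = (1 - e) * (T v i - T w i) + e * (x i - y i)"
    using i by (simp add: averaged_step_def algebra_simps)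
  also have "\<bar>\<dots>\<bar> \<le> (1 - e) * \<bar>T v i - T w i\<bar> + e * \<bar>x i - y i\<bar>"
    using e by (intro order_trans[OF abs_triangle_ineq]) (simp add: abs_mult)
  also have "\<dots> \<le> (1 - e) * linf_dist n v w + e * linf_dist n x y"
    using e 1 abs_coord_le_linf_dist[OF i, of x y] by (intro add_mono mult_left_mono) auto
  finally show "\<bar>averaged_step e x v i - averaged_step e y w i\<bar>
    \<le> (1 - e) * linf_dist n v w + e * linf_dist n x y" .
qed

lemma iter_Lip:
  assumes e: "0 \<le> e" "e \<le> 1" and x: "x \<in> {1..n} \<rightarrow>\<^sub>E UNIV" and y: "y \<in> {1..n} \<rightarrow>\<^sub>E UNIV"
  shows "linf_dist n (iter e m x) (iter e m y) \<le> linf_dist n x y"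
proof (induction m)
  case (Suc m)
  have "linf_dist n (iter e (Suc m) x) (iter e (Suc m) y)
      \<le> (1 - e) * linf_dist n (iter e m x) (iter e m y) + e * linf_dist n x y"
    unfolding iter_Suc by (intro averaged_step_dist e iter_in x y)
  also have "\<dots> \<le> (1 - e) * linf_dist n x y + e * linf_dist n x y"
    using e Suc by (intro add_mono mult_left_mono) auto
  finally show ?case by (simp add: algebra_simps)
qed simp

lemma iter_fixed:
  assumes x: "x \<in> {1..n} \<rightarrow>\<^sub>E UNIV" and Tx: "T x = x"
  shows "iter e m x = x"
proof (induction m)
  case (Suc m)
  then have "iter e (Suc m) x = (\<lambda>i\<in>{1..n}. x i)"
    by (simp add: iter_Suc averaged_step_def Tx algebra_simps cong: restrict_cong)
  also have "\<dots> = x"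
    using x by (simp add: PiE_restrict)
  finally show ?case .
qed simp

text \<open>The fixed point \<open>q\<close> anchors the iteration: each iterate stays within the
  initial distance of \<open>q\<close>, which gives the bounds needed for compactness.\<close>

lemma iter_dist_q:
  assumes e: "0 \<le> e" "e \<le> 1" and x: "x \<in> {1..n} \<rightarrow>\<^sub>E UNIV"
  shows "linf_dist n (iter e m x) q \<le> linf_dist n x q"
  using iter_Lip[OF e x q_in, of m] iter_fixed[OF q_in T_q, of e m] by simp

text \<open>The first two iterates both lie within \<open>linf_dist n x q\<close> of
  \<open>q\<close>, which explains the factor 2; each further step, taken with the same
  \<open>x\<close>, contracts by \<open>1 - e\<close>.\<close>

lemma iter_increment:
  assumes e: "0 \<le> e" "e \<le> 1" and x: "x \<in> {1..n} \<rightarrow>\<^sub>E UNIV"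
  shows "linf_dist n (iter e (Suc m) x) (iter e m x) \<le> (1 - e) ^ m * (2 * linf_dist n x q)"
proof (induction m)
  case 0
  show ?case
    using linf_dist_triangle[of n "iter e (Suc 0) x" x q] iter_dist_q[OF e x, of "Suc 0"]
    by (simp add: linf_dist_commute[of n q])
next
  case (Suc m)
  have "linf_dist n (iter e (Suc (Suc m)) x) (iter e (Suc m) x)
      \<le> (1 - e) * linf_dist n (iter e (Suc m) x) (iter e m x) + e * linf_dist n x x"
    unfolding iter_Suc[of e "Suc m"] iter_Suc[of e m x]
    by (intro averaged_step_dist e iter_in x) (simp add: averaged_step_def)
  also have "linf_dist n x x = 0"
    by (simp add: linf_dist_def)
  also have "(1 - e) * linf_dist n (iter e (Suc m) x) (iter e m x)
      \<le> (1 - e) * ((1 - e) ^ m * (2 * linf_dist n x q))"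
    using e Suc by (intro mult_left_mono) auto
  finally show ?case by (simp add: mult.assoc)
qed

text \<open>With \<open>w = iter e m x\<close>, the defect \<open>T w - w\<close> is the next
  increment minus \<open>e * (x - T w)\<close>. The increment is at most
  \<open>2 * e * linf_dist n x q\<close> by the choice of \<open>m\<close>; so is the other term,
  because \<open>x\<close> and \<open>T w\<close> both lie within \<open>linf_dist n x q\<close> of
  \<open>q\<close>.\<close>

lemma iter_almost_fixed:
  assumes e: "0 \<le> e" "e \<le> 1" and x: "x \<in> {1..n} \<rightarrow>\<^sub>E UNIV" and small: "(1 - e) ^ m \<le> e"
  shows "linf_dist n (T (iter e m x)) (iter e m x) \<le> 4 * e * linf_dist n x q"
proof (rule linf_dist_leI)
  let ?w = "iter e m x" and ?d = "linf_dist n x q"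
  show "0 \<le> 4 * e * ?d" using e by (simp add: linf_dist_nonneg)
  fix i assume i: "i \<in> {1..n}"
  have "linf_dist n (T ?w) (T q) \<le> ?d"
    using T_Lip[OF iter_in[OF x] q_in] iter_dist_q[OF e x] by (rule order_trans)
  then have "\<bar>x i - T ?w i\<bar> \<le> 2 * ?d"
    using abs_coord_le_linf_dist[OF i, of x q] abs_coord_le_linf_dist[OF i, of "T ?w" q]
    by (simp add: T_q)
  then have 1: "e * \<bar>x i - T ?w i\<bar> \<le> e * (2 * ?d)"
    using e by (intro mult_left_mono)
  have "\<bar>iter e (Suc m) x i - ?w i\<bar> \<le> (1 - e) ^ m * (2 * ?d)"
    using abs_coord_le_linf_dist[OF i] iter_increment[OF e x] by (rule order_trans)
  also have "\<dots> \<le> e * (2 * ?d)"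
    using small by (intro mult_right_mono) (auto simp: linf_dist_nonneg)
  finally have 2: "\<bar>iter e (Suc m) x i - ?w i\<bar> \<le> e * (2 * ?d)" .
  have "iter e (Suc m) x i = T ?w i + e * (x i - T ?w i)"
    using i by (simp add: iter_Suc averaged_step_def algebra_simps)
  then have "T ?w i - ?w i = (iter e (Suc m) x i - ?w i) - e * (x i - T ?w i)"
    by simp
  then have "\<bar>T ?w i - ?w i\<bar> \<le> \<bar>iter e (Suc m) x i - ?w i\<bar> + e * \<bar>x i - T ?w i\<bar>"
    using e by (metis abs_mult abs_of_nonneg abs_triangle_ineq4)
  then show "\<bar>T ?w i - ?w i\<bar> \<le> 4 * e * ?d"
    using 1 2 by linarith
qed

lemma almost_fixed_sequence:
  obtains Z :: "nat \<Rightarrow> (nat \<Rightarrow> real) \<Rightarrow> nat \<Rightarrow> real" where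
    "\<And>k x. x \<in> {1..n} \<rightarrow>\<^sub>E UNIV \<Longrightarrow> Z k x \<in> {1..n} \<rightarrow>\<^sub>E UNIV"
    "\<And>k x y. \<lbrakk>x \<in> {1..n} \<rightarrow>\<^sub>E UNIV; y \<in> {1..n} \<rightarrow>\<^sub>E UNIV\<rbrakk>
      \<Longrightarrow> linf_dist n (Z k x) (Z k y) \<le> linf_dist n x y"
    "\<And>k x. \<lbrakk>x \<in> {1..n} \<rightarrow>\<^sub>E UNIV; T x = x\<rbrakk> \<Longrightarrow> Z k x = x"
    "\<And>k x. x \<in> {1..n} \<rightarrow>\<^sub>E UNIV
      \<Longrightarrow> linf_dist n (T (Z k x)) (Z k x) \<le> 4 * (1 / Suc k) * linf_dist n x q"
proof -
  have "\<exists>m. (1 - 1 / Suc k) ^ m \<le> 1 / real (Suc k)" for k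
  proof -
    have "0 \<le> 1 - 1 / real (Suc k)" "1 - 1 / real (Suc k) < 1" "0 < 1 / real (Suc k)" by simp_all
    then show ?thesis
      using real_arch_pow_inv[of "1 / real (Suc k)" "1 - 1 / real (Suc k)"] less_imp_le by blast
  qed
  then obtain m where m: "\<And>k. (1 - 1 / Suc k) ^ m k \<le> 1 / real (Suc k)" by metis
  have e: "0 \<le> 1 / real (Suc k)" "1 / real (Suc k) \<le> 1" for k by simp_all
  show ?thesis
  proof (rule that[of "\<lambda>k. iter (1 / real (Suc k)) (m k)"])
  qed (assumption | rule iter_in iter_Lip iter_fixed iter_almost_fixed e m)+
qed

text \<open>A cluster function of the almost fixed sequence is the retraction. Being 1-Lipschitz,
  fixing the fixed points of \<open>T\<close> and having defect tending to 0 each concern only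
  finitely many coordinates at a time, so they survive the passage to the cluster function.\<close>

lemma nonexpansive_retraction:
  "\<exists>R. linf_retraction n {x \<in> {1..n} \<rightarrow>\<^sub>E UNIV. T x = x} R"
proof -
  let ?X = "{1..n} \<rightarrow>\<^sub>E (UNIV :: real set)"
  obtain Z where Z_in: "\<And>k x. x \<in> ?X \<Longrightarrow> Z k x \<in> ?X"
    and Z_Lip: "\<And>k x y. \<lbrakk>x \<in> ?X; y \<in> ?X\<rbrakk> \<Longrightarrow> linf_dist n (Z k x) (Z k y) \<le> linf_dist n x y"
    and Z_fixed: "\<And>k x. \<lbrakk>x \<in> ?X; T x = x\<rbrakk> \<Longrightarrow> Z k x = x"
    and Z_T: "\<And>k x. x \<in> ?X
      \<Longrightarrow> linf_dist n (T (Z k x)) (Z k x) \<le> 4 * (1 / Suc k) * linf_dist n x q"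
    by (rule almost_fixed_sequence) blast
  \<comment> \<open>The maps \<open>Z k\<close> become one real family indexed by pairs of a point
    and a coordinate. The value 0 at meaningless pairs keeps the family bounded at every
    index.\<close>
  define Y where "Y k p = (if fst p \<in> ?X \<and> snd p \<in> {1..n} then Z k (fst p) (snd p) else 0)"
    for k and p :: "(nat \<Rightarrow> real) \<times> nat"
  have "\<bar>Y k p\<bar> \<le> linf_dist n (fst p) q + \<bar>q (snd p)\<bar>" for k p
  proof (cases "fst p \<in> ?X \<and> snd p \<in> {1..n}")
    case True
    then have "\<bar>Z k (fst p) (snd p) - q (snd p)\<bar> \<le> linf_dist n (Z k (fst p)) q"
      by (intro abs_coord_le_linf_dist) auto
    also have "\<dots> \<le> linf_dist n (fst p) q"
      using Z_Lip[of "fst p" q k] Z_fixed[OF q_in T_q] True q_in by simp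
    finally show ?thesis using True by (simp add: Y_def)
  next
    case False
    then have "Y k p = 0" by (simp only: Y_def if_False)
    then show ?thesis by (simp add: linf_dist_nonneg)
  qed
  then obtain r where
    r: "\<And>S e k0. \<lbrakk>finite S; 0 < e\<rbrakk> \<Longrightarrow> \<exists>k\<ge>k0. \<forall>s\<in>S. \<bar>Y k s - r s\<bar> < e"
    by (rule pointwise_bounded_cluster_function[of Y]) blast
  define R where "R x = (\<lambda>i\<in>{1..n}. r (x, i))" for x
  have R_in: "R x \<in> ?X" for x by (simp add: R_def)
  \<comment> \<open>One index \<open>k\<close> must serve both \<open>x\<close> and
    \<open>y\<close>, since the Lipschitz estimate compares \<open>Z k x\<close> with
    \<open>Z k y\<close> for the same \<open>k\<close>.\<close>
  have approx: "\<exists>k\<ge>k0. linf_dist n (Z k x) (R x) \<le> e \<and> linf_dist n (Z k y) (R y) \<le> e"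
    if "x \<in> ?X" "y \<in> ?X" "0 < e" for x y e k0
  proof -
    obtain k where k: "k \<ge> k0" "\<forall>s\<in>{x, y} \<times> {1..n}. \<bar>Y k s - r s\<bar> < e"
      using r[of "{x, y} \<times> {1..n}" e k0] \<open>0 < e\<close> by blast
    have "linf_dist n (Z k z) (R z) \<le> e" if "z \<in> {x, y}" for z
    proof (rule linf_dist_leI)
      fix i assume "i \<in> {1..n}"
      then have "\<bar>Y k (z, i) - r (z, i)\<bar> < e" using k that by blast
      then show "\<bar>Z k z i - R z i\<bar> \<le> e"
        using \<open>i \<in> {1..n}\<close> that \<open>x \<in> ?X\<close> \<open>y \<in> ?X\<close> by (auto simp: Y_def R_def)
    qed (use \<open>0 < e\<close> in simp)
    with k show ?thesis by blast
  qed
  have eqI: "v = w" if "v \<in> ?X" "w \<in> ?X" and le: "\<And>e. 0 < e \<Longrightarrow> linf_dist n v w \<le> e" for v w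
  proof -
    have "linf_dist n v w \<le> 0"
      by (rule field_le_epsilon) (simp add: le)
    then have "linf_dist n v w = 0"
      using linf_dist_nonneg[of n v w] by simp
    then show ?thesis
      using Metric_space.zero[OF Metric_space_linf that(1,2)] by simp
  qed
  have R_T: "T (R x) = R x" if x: "x \<in> ?X" for x
  proof (rule eqI[OF T_in[OF R_in] R_in])
    fix e :: real assume e: "0 < e"
    define d where "d = linf_dist n x q"
    have d: "0 \<le> d" by (simp add: d_def linf_dist_nonneg)
    \<comment> \<open>This makes the defect of \<open>Z k x\<close> at most \<open>e / 2\<close>;
      the two passages between \<open>Z k x\<close> and \<open>R x\<close> cost \<open>e / 4\<close>
      each.\<close>
    obtain k0 :: nat where k0: "8 * d / e < real k0"
      using reals_Archimedean2 by blast
    obtain k where k: "k \<ge> k0" "linf_dist n (Z k x) (R x) \<le> e / 4"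
      using approx[OF x x, of "e / 4" k0] e by auto
    have "8 * d / e < real (Suc k)" using k0 k by simp
    then have "4 * (1 / Suc k) * d \<le> e / 2"
      using e by (simp add: field_simps)
    then have "linf_dist n (T (Z k x)) (Z k x) \<le> e / 2"
      using Z_T[OF x, of k] d_def by simp
    moreover have "linf_dist n (T (R x)) (T (Z k x)) \<le> e / 4"
      using T_Lip[OF R_in Z_in[OF x], of x k] k by (simp add: linf_dist_commute)
    ultimately show "linf_dist n (T (R x)) (R x) \<le> e"
      using linf_dist_triangle[of n "T (R x)" "R x" "T (Z k x)"]
        linf_dist_triangle[of n "T (Z k x)" "R x" "Z k x"] k by linarith
  qed
  have R_Lip: "linf_dist n (R x) (R y) \<le> linf_dist n x y" if x: "x \<in> ?X" and y: "y \<in> ?X" for x y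
  proof (rule field_le_epsilon)
    fix e :: real assume e: "0 < e"
    obtain k where k: "linf_dist n (Z k x) (R x) \<le> e / 2" "linf_dist n (Z k y) (R y) \<le> e / 2"
      using approx[OF x y, of "e / 2"] e by auto
    then show "linf_dist n (R x) (R y) \<le> linf_dist n x y + e"
      using linf_dist_triangle[of n "R x" "R y" "Z k x"]
        linf_dist_triangle[of n "Z k x" "R y" "Z k y"] Z_Lip[OF x y, of k]
        linf_dist_commute[of n "Z k x" "R x"] by linarith
  qed
  have R_fixed: "R x = x" if x: "x \<in> ?X" and Tx: "T x = x" for x
  proof (rule eqI[OF R_in x])
    fix e :: real assume e: "0 < e"
    obtain k where "linf_dist n (Z k x) (R x) \<le> e"
      using approx[OF x x e] by blast
    then show "linf_dist n (R x) x \<le> e"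
      by (simp add: Z_fixed[OF x Tx] linf_dist_commute[of n x])
  qed
  show ?thesis
    unfolding linf_retraction_def one_Lipschitz_map_def
    using R_in R_T R_Lip R_fixed by (intro exI[of _ R]) auto
qed

end

section \<open>Infima and suprema of Lipschitz families\<close>

text \<open>In the applications \<open>h\<close> and \<open>k\<close> are one Lipschitz family
  evaluated at two points, so boundedness at a single point spreads to all points.\<close>

lemma bdd_below_shift:
  fixes h k :: "'a \<Rightarrow> real"
  assumes "bdd_below (h ` A)" "\<And>a. a \<in> A \<Longrightarrow> \<bar>h a - k a\<bar> \<le> c"
  shows "bdd_below (k ` A)"
proof -
  obtain m where "\<And>a. a \<in> A \<Longrightarrow> m \<le> h a"
    using assms(1) by (auto simp: bdd_below_def)
  then show ?thesis
    using assms(2) by (intro bdd_belowI2[of _ "m - c"]) (smt (verit))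
qed

lemma bdd_above_shift:
  fixes h k :: "'a \<Rightarrow> real"
  assumes "bdd_above (h ` A)" "\<And>a. a \<in> A \<Longrightarrow> \<bar>h a - k a\<bar> \<le> c"
  shows "bdd_above (k ` A)"
proof -
  obtain m where "\<And>a. a \<in> A \<Longrightarrow> h a \<le> m"
    using assms(1) by (auto simp: bdd_above_def)
  then show ?thesis
    using assms(2) by (intro bdd_aboveI2[of _ _ "m + c"]) (smt (verit))
qed

lemma abs_INF_diff_le:
  fixes h k :: "'a \<Rightarrow> real"
  assumes "A \<noteq> {}" "bdd_below (h ` A)" "\<And>a. a \<in> A \<Longrightarrow> \<bar>h a - k a\<bar> \<le> c"
  shows "\<bar>(INF a\<in>A. h a) - (INF a\<in>A. k a)\<bar> \<le> c"
proof -
  have k: "bdd_below (k ` A)" using bdd_below_shift assms(2,3) .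
  have "(INF a\<in>A. h a) - c \<le> (INF a\<in>A. k a)"
  proof (rule cINF_greatest[OF assms(1)])
    show "(INF a\<in>A. h a) - c \<le> k a" if "a \<in> A" for a
      using cINF_lower[OF assms(2) that] assms(3)[OF that] by linarith
  qed
  moreover have "(INF a\<in>A. k a) - c \<le> (INF a\<in>A. h a)"
  proof (rule cINF_greatest[OF assms(1)])
    show "(INF a\<in>A. k a) - c \<le> h a" if "a \<in> A" for a
      using cINF_lower[OF k that] assms(3)[OF that] by linarith
  qed
  ultimately show ?thesis by linarith
qed

lemma abs_SUP_diff_le:
  fixes h k :: "'a \<Rightarrow> real"
  assumes "A \<noteq> {}" "bdd_above (h ` A)" "\<And>a. a \<in> A \<Longrightarrow> \<bar>h a - k a\<bar> \<le> c"
  shows "\<bar>(SUP a\<in>A. h a) - (SUP a\<in>A. k a)\<bar> \<le> c"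
proof -
  have k: "bdd_above (k ` A)" using bdd_above_shift assms(2,3) .
  have "(SUP a\<in>A. h a) \<le> (SUP a\<in>A. k a) + c"
  proof (rule cSUP_least[OF assms(1)])
    show "h a \<le> (SUP a\<in>A. k a) + c" if "a \<in> A" for a
      using cSUP_upper[OF that k] assms(3)[OF that] by linarith
  qed
  moreover have "(SUP a\<in>A. k a) \<le> (SUP a\<in>A. h a) + c"
  proof (rule cSUP_least[OF assms(1)])
    show "k a \<le> (SUP a\<in>A. h a) + c" if "a \<in> A" for a
      using cSUP_upper[OF that assms(2)] assms(3)[OF that] by linarith
  qed
  ultimately show ?thesis by linarith
qed

text \<open>McShane's formula: the infimum of the cones \<open>f a + mdist B a x\<close> over
  \<open>a\<close> in \<open>A\<close>. It is finite at a point \<open>b\<close> of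
  \<open>A\<close>, where \<open>f b\<close> is a lower bound, and hence everywhere.\<close>

lemma real_Lipschitz_extension:
  fixes f :: "'b \<Rightarrow> real"
  assumes A: "A \<subseteq> mspace B" "A \<noteq> {}"
    and f: "\<And>a b. \<lbrakk>a \<in> A; b \<in> A\<rbrakk> \<Longrightarrow> \<bar>f a - f b\<bar> \<le> mdist B a b"
  obtains F where "\<And>a. a \<in> A \<Longrightarrow> F a = f a"
    "\<And>x y. \<lbrakk>x \<in> mspace B; y \<in> mspace B\<rbrakk> \<Longrightarrow> \<bar>F x - F y\<bar> \<le> mdist B x y"
proof -
  define F where "F x = (INF a\<in>A. f a + mdist B a x)" for x
  have diff: "\<bar>(f a + mdist B a x) - (f a + mdist B a y)\<bar> \<le> mdist B x y"
    if "a \<in> A" "x \<in> mspace B" "y \<in> mspace B" for a x y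
  proof -
    have "a \<in> mspace B" using that A by blast
    then show ?thesis
      using mdist_triangle[of a B x y] mdist_triangle[of a B y x] mdist_commute[of B x y] that
      by (simp add: abs_le_iff)
  qed
  have lower: "f b \<le> f a + mdist B a b" if "a \<in> A" "b \<in> A" for a b
    using f[OF that] by linarith
  obtain b where b: "b \<in> A" using A by blast
  have "bdd_below ((\<lambda>a. f a + mdist B a b) ` A)"
    using lower b by (intro bdd_belowI2) blast
  then have bdd: "bdd_below ((\<lambda>a. f a + mdist B a x) ` A)" if "x \<in> mspace B" for x
  proof (rule bdd_below_shift)
    show "\<bar>(f a + mdist B a b) - (f a + mdist B a x)\<bar> \<le> mdist B b x" if "a \<in> A" for a
      using diff that b A \<open>x \<in> mspace B\<close> by blast
  qed
  show ?thesis
  proof (rule that[of F])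
    fix a assume a: "a \<in> A"
    then have aB: "a \<in> mspace B" using A by blast
    have "F a \<le> f a + mdist B a a"
      unfolding F_def using a aB bdd by (intro cINF_lower) auto
    moreover have "f a \<le> F a"
      unfolding F_def using a A lower by (intro cINF_greatest) auto
    ultimately show "F a = f a" using mdist_zero[OF aB aB] by simp
  next
    fix x y assume "x \<in> mspace B" "y \<in> mspace B"
    then show "\<bar>F x - F y\<bar> \<le> mdist B x y"
      unfolding F_def using diff bdd A by (intro abs_INF_diff_le) auto
  qed
qed

section \<open>Solution sets of Lipschitz inequalities\<close>

text \<open>One half of the clamp, kept real-valued although \<open>lo\<close> may be the constant
  minus infinity; in that case \<open>t y s = s\<close>.\<close>

lemma bound_function_max:
  assumes "bound_function m (- \<infinity>) lo"
  obtains t :: "(nat \<Rightarrow> real) \<Rightarrow> real \<Rightarrow> real" where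
    "\<And>y s. y \<in> {1..m} \<rightarrow>\<^sub>E UNIV \<Longrightarrow> ereal (t y s) = max (lo y) (ereal s)"
    "\<And>y y' s s'. \<lbrakk>y \<in> {1..m} \<rightarrow>\<^sub>E UNIV; y' \<in> {1..m} \<rightarrow>\<^sub>E UNIV\<rbrakk>
      \<Longrightarrow> \<bar>t y s - t y' s'\<bar> \<le> max \<bar>s - s'\<bar> (linf_dist m y y')"
proof -
  show ?thesis
    using assms unfolding bound_function_def mspace_linf
  proof (elim disjE exE conjE)
    fix f
    assume f: "one_Lipschitz_map (linf m) euclidean_metric f"
      "\<forall>y\<in>{1..m} \<rightarrow>\<^sub>E UNIV. lo y = ereal (f y)"
    show ?thesis
    proof (rule that[of "\<lambda>y s. max (f y) s"])
      fix y y' :: "nat \<Rightarrow> real" and s s' :: real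
      assume "y \<in> {1..m} \<rightarrow>\<^sub>E UNIV" "y' \<in> {1..m} \<rightarrow>\<^sub>E UNIV"
      then have "\<bar>f y - f y'\<bar> \<le> linf_dist m y y'"
        using f(1) unfolding one_Lipschitz_map_def by (simp add: dist_real_def)
      then show "\<bar>max (f y) s - max (f y') s'\<bar> \<le> max \<bar>s - s'\<bar> (linf_dist m y y')"
        by linarith
    qed (simp add: f(2))
  next
    assume "\<forall>y\<in>{1..m} \<rightarrow>\<^sub>E UNIV. lo y = - \<infinity>"
    then show ?thesis by (intro that[of "\<lambda>y s. s"]) simp_all
  qed
qed

lemma bound_function_min:
  assumes "bound_function m \<infinity> up"
  obtains t :: "(nat \<Rightarrow> real) \<Rightarrow> real \<Rightarrow> real" where
    "\<And>y s. y \<in> {1..m} \<rightarrow>\<^sub>E UNIV \<Longrightarrow> ereal (t y s) = min (up y) (ereal s)"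
    "\<And>y y' s s'. \<lbrakk>y \<in> {1..m} \<rightarrow>\<^sub>E UNIV; y' \<in> {1..m} \<rightarrow>\<^sub>E UNIV\<rbrakk>
      \<Longrightarrow> \<bar>t y s - t y' s'\<bar> \<le> max \<bar>s - s'\<bar> (linf_dist m y y')"
proof -
  show ?thesis
    using assms unfolding bound_function_def mspace_linf
  proof (elim disjE exE conjE)
    fix f
    assume f: "one_Lipschitz_map (linf m) euclidean_metric f"
      "\<forall>y\<in>{1..m} \<rightarrow>\<^sub>E UNIV. up y = ereal (f y)"
    show ?thesis
    proof (rule that[of "\<lambda>y s. min (f y) s"])
      fix y y' :: "nat \<Rightarrow> real" and s s' :: real
      assume "y \<in> {1..m} \<rightarrow>\<^sub>E UNIV" "y' \<in> {1..m} \<rightarrow>\<^sub>E UNIV"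
      then have "\<bar>f y - f y'\<bar> \<le> linf_dist m y y'"
        using f(1) unfolding one_Lipschitz_map_def by (simp add: dist_real_def)
      then show "\<bar>min (f y) s - min (f y') s'\<bar> \<le> max \<bar>s - s'\<bar> (linf_dist m y y')"
        by linarith
    qed (simp add: f(2))
  next
    assume "\<forall>y\<in>{1..m} \<rightarrow>\<^sub>E UNIV. up y = \<infinity>"
    then show ?thesis by (intro that[of "\<lambda>y s. s"]) simp_all
  qed
qed

text \<open>First cut off above, then below. The estimate by a maximum, unlike one by a sum, does
  not grow under this composition.\<close>

lemma bound_function_clamp:
  assumes lo: "bound_function m (- \<infinity>) lo" and up: "bound_function m \<infinity> up"
    and le: "\<And>y. y \<in> {1..m} \<rightarrow>\<^sub>E UNIV \<Longrightarrow> lo y \<le> up y"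
  shows "\<exists>t :: (nat \<Rightarrow> real) \<Rightarrow> real \<Rightarrow> real.
    (\<forall>y\<in>{1..m} \<rightarrow>\<^sub>E UNIV. \<forall>s. t y s = s \<longleftrightarrow> lo y \<le> ereal s \<and> ereal s \<le> up y) \<and>
    (\<forall>y\<in>{1..m} \<rightarrow>\<^sub>E UNIV. \<forall>y'\<in>{1..m} \<rightarrow>\<^sub>E UNIV. \<forall>s s'.
      \<bar>t y s - t y' s'\<bar> \<le> max \<bar>s - s'\<bar> (linf_dist m y y'))"
proof -
  obtain tl :: "(nat \<Rightarrow> real) \<Rightarrow> real \<Rightarrow> real" where
    tl: "\<And>y s. y \<in> {1..m} \<rightarrow>\<^sub>E UNIV \<Longrightarrow> ereal (tl y s) = max (lo y) (ereal s)"
      "\<And>y y' s s'. \<lbrakk>y \<in> {1..m} \<rightarrow>\<^sub>E UNIV; y' \<in> {1..m} \<rightarrow>\<^sub>E UNIV\<rbrakk>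
      \<Longrightarrow> \<bar>tl y s - tl y' s'\<bar> \<le> max \<bar>s - s'\<bar> (linf_dist m y y')"
    by (rule bound_function_max[OF lo]) blast
  obtain tu :: "(nat \<Rightarrow> real) \<Rightarrow> real \<Rightarrow> real" where
    tu: "\<And>y s. y \<in> {1..m} \<rightarrow>\<^sub>E UNIV \<Longrightarrow> ereal (tu y s) = min (up y) (ereal s)"
      "\<And>y y' s s'. \<lbrakk>y \<in> {1..m} \<rightarrow>\<^sub>E UNIV; y' \<in> {1..m} \<rightarrow>\<^sub>E UNIV\<rbrakk>
      \<Longrightarrow> \<bar>tu y s - tu y' s'\<bar> \<le> max \<bar>s - s'\<bar> (linf_dist m y y')"
    by (rule bound_function_min[OF up]) blast
  show ?thesis
  proof (intro exI[of _ "\<lambda>y s. tl y (tu y s)"] conjI ballI allI)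
    fix y :: "nat \<Rightarrow> real" and s :: real
    assume y: "y \<in> {1..m} \<rightarrow>\<^sub>E UNIV"
    have "tl y (tu y s) = s \<longleftrightarrow> max (lo y) (min (up y) (ereal s)) = ereal s"
      using tl(1)[OF y, of "tu y s"] tu(1)[OF y, of s] by (metis ereal.inject)
    \<comment> \<open>Here the order of the bounds matters: if \<open>up y < lo y\<close> and
      \<open>s = lo y\<close>, then \<open>s\<close> would be fixed although it exceeds
      \<open>up y\<close>.\<close>
    also have "\<dots> \<longleftrightarrow> lo y \<le> ereal s \<and> ereal s \<le> up y"
      using le[OF y] by (auto simp: max_def min_def)
    finally show "tl y (tu y s) = s \<longleftrightarrow> lo y \<le> ereal s \<and> ereal s \<le> up y" .
  next
    fix y y' :: "nat \<Rightarrow> real" and s s' :: real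
    assume "y \<in> {1..m} \<rightarrow>\<^sub>E UNIV" "y' \<in> {1..m} \<rightarrow>\<^sub>E UNIV"
    from tl(2)[OF this, of "tu y s" "tu y' s'"] tu(2)[OF this, of s s']
    show "\<bar>tl y (tu y s) - tl y' (tu y' s')\<bar> \<le> max \<bar>s - s'\<bar> (linf_dist m y y')"
      by linarith
  qed
qed

lemma Lipschitz_bounded_form_retraction:
  assumes form: "Lipschitz_bounded_form n Q" and "Q \<noteq> {}"
  shows "\<exists>R. linf_retraction n Q R"
proof -
  obtain lo up :: "nat \<Rightarrow> (nat \<Rightarrow> real) \<Rightarrow> ereal" where
    b: "\<forall>i\<in>{1..n}. bound_function (n - 1) (- \<infinity>) (lo i) \<and> bound_function (n - 1) \<infinity> (up i) \<and>
      (\<forall>y\<in>{1..n - 1} \<rightarrow>\<^sub>E UNIV. lo i y \<le> up i y)"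
    and Q: "Q = {x \<in> {1..n} \<rightarrow>\<^sub>E UNIV. \<forall>i\<in>{1..n}.
               lo i (omit n i x) \<le> ereal (x i) \<and> ereal (x i) \<le> up i (omit n i x)}"
    using form unfolding Lipschitz_bounded_form_def mspace_linf by (elim exE conjE)
  have "\<forall>i\<in>{1..n}. \<exists>t :: (nat \<Rightarrow> real) \<Rightarrow> real \<Rightarrow> real.
    (\<forall>y\<in>{1..n-1} \<rightarrow>\<^sub>E UNIV. \<forall>s. t y s = s \<longleftrightarrow> lo i y \<le> ereal s \<and> ereal s \<le> up i y) \<and>
    (\<forall>y\<in>{1..n-1} \<rightarrow>\<^sub>E UNIV. \<forall>y'\<in>{1..n-1} \<rightarrow>\<^sub>E UNIV. \<forall>s s'.
      \<bar>t y s - t y' s'\<bar> \<le> max \<bar>s - s'\<bar> (linf_dist (n - 1) y y'))"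
    using b by (intro ballI bound_function_clamp) auto
  from bchoice[OF this] obtain t :: "nat \<Rightarrow> (nat \<Rightarrow> real) \<Rightarrow> real \<Rightarrow> real" where
    t: "\<forall>i\<in>{1..n}. (\<forall>y\<in>{1..n-1} \<rightarrow>\<^sub>E UNIV. \<forall>s.
        t i y s = s \<longleftrightarrow> lo i y \<le> ereal s \<and> ereal s \<le> up i y) \<and>
      (\<forall>y\<in>{1..n-1} \<rightarrow>\<^sub>E UNIV. \<forall>y'\<in>{1..n-1} \<rightarrow>\<^sub>E UNIV. \<forall>s s'.
        \<bar>t i y s - t i y' s'\<bar> \<le> max \<bar>s - s'\<bar> (linf_dist (n - 1) y y'))"
    by (elim exE)
  have t_eq: "t i (omit n i x) s = s \<longleftrightarrow> lo i (omit n i x) \<le> ereal s \<and> ereal s \<le> up i (omit n i x)"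
    if "i \<in> {1..n}" for i x s
    using bspec[OF conjunct1[OF bspec[OF t that]] omit_in_mspace] by (rule spec)
  have t_Lip: "\<bar>t i (omit n i x) s - t i (omit n i y) s'\<bar>
      \<le> max \<bar>s - s'\<bar> (linf_dist (n - 1) (omit n i x) (omit n i y))"
    if "i \<in> {1..n}" for i x y s s'
    using bspec[OF bspec[OF conjunct2[OF bspec[OF t that]] omit_in_mspace] omit_in_mspace] by simp
  \<comment> \<open>All coordinates are clamped at once, each by the old values of the others. So
    \<open>T x\<close> need not lie in \<open>Q\<close>; only the fixed points of \<open>T\<close>
    are the points of \<open>Q\<close>.\<close>
  define T where "T x = (\<lambda>i\<in>{1..n}. t i (omit n i x) (x i))" for x
  have T_fixed: "T x = x \<longleftrightarrow> x \<in> Q" if x: "x \<in> {1..n} \<rightarrow>\<^sub>E UNIV" for x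
  proof -
    have "T x = x \<longleftrightarrow> (\<forall>i\<in>{1..n}. T x i = x i)"
    proof (intro iffI ballI)
      assume "\<forall>i\<in>{1..n}. T x i = x i"
      then show "T x = x"
        using x by (intro PiE_ext[of "T x" "{1..n}" "\<lambda>_. UNIV" x]) (simp_all add: T_def)
    qed simp
    also have "\<dots> \<longleftrightarrow> (\<forall>i\<in>{1..n}. t i (omit n i x) (x i) = x i)"
      by (simp add: T_def)
    also have "\<dots> \<longleftrightarrow> x \<in> Q"
      using x by (simp add: Q t_eq del: atLeastAtMost_iff One_nat_def)
    finally show ?thesis .
  qed
  obtain q where q: "q \<in> Q" using \<open>Q \<noteq> {}\<close> by blast
  interpret nonexpansive_self_map n T q
  proof
    fix x y :: "nat \<Rightarrow> real"
    assume "x \<in> {1..n} \<rightarrow>\<^sub>E UNIV" "y \<in> {1..n} \<rightarrow>\<^sub>E UNIV"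
    show "linf_dist n (T x) (T y) \<le> linf_dist n x y"
    proof (rule linf_dist_leI)
      fix i assume i: "i \<in> {1..n}"
      \<comment> \<open>By \<open>linf_dist_omit\<close> the maximum in \<open>t_Lip\<close> is
        exactly \<open>linf_dist n x y\<close>.\<close>
      then show "\<bar>T x i - T y i\<bar> \<le> linf_dist n x y"
        unfolding linf_dist_omit[OF i] using t_Lip[OF i]
        by (simp add: T_def)
    qed (rule linf_dist_nonneg)
  next
    show "T q = q" using q T_fixed Q by blast
  qed (use q Q in \<open>auto simp: T_def\<close>)
  have "{x \<in> {1..n} \<rightarrow>\<^sub>E UNIV. T x = x} = Q"
    using T_fixed Q by blast
  then show ?thesis using nonexpansive_retraction by simp
qed

lemma injective_metric_retract:
  assumes Q: "Q \<subseteq> {1..n} \<rightarrow>\<^sub>E UNIV" "Q \<noteq> {}"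
    and "linf_retraction n Q R"
  shows "injective_metric TYPE('b) (submetric (linf n) Q)"
  unfolding injective_metric_def
proof (intro allI impI, elim conjE)
  note R = linf_retractionD[OF \<open>linf_retraction n Q R\<close>]
  fix B :: "'b metric" and A :: "'b set" and \<Phi> :: "'b \<Rightarrow> nat \<Rightarrow> real"
  assume A: "A \<subseteq> mspace B" and Lip: "one_Lipschitz_map (submetric B A) (submetric (linf n) Q) \<Phi>"
  have \<Phi>: "\<Phi> a \<in> Q" if "a \<in> A" for a
    using Lip A that unfolding one_Lipschitz_map_def by auto
  have \<Phi>_Lip: "linf_dist n (\<Phi> a) (\<Phi> b) \<le> mdist B a b" if "a \<in> A" "b \<in> A" for a b
    using Lip A that unfolding one_Lipschitz_map_def by (simp add: subset_eq)
  \<comment> \<open>Following an extension by \<open>R\<close> reduces the problem to extending into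
    the whole space, which is done one coordinate at a time.\<close>
  have RI: "\<exists>\<Psi>. one_Lipschitz_map B (submetric (linf n) Q) \<Psi> \<and> (\<forall>a\<in>A. \<Psi> a = \<Phi> a)"
    if G: "\<And>b. G b \<in> {1..n} \<rightarrow>\<^sub>E UNIV"
      "\<And>b c. \<lbrakk>b \<in> mspace B; c \<in> mspace B\<rbrakk> \<Longrightarrow> linf_dist n (G b) (G c) \<le> mdist B b c"
      "\<And>a. a \<in> A \<Longrightarrow> G a = \<Phi> a" for G
  proof (intro exI[of _ "\<lambda>b. R (G b)"] conjI ballI)
    show "one_Lipschitz_map B (submetric (linf n) Q) (\<lambda>b. R (G b))"
      unfolding one_Lipschitz_map_def
    proof (intro conjI ballI)
      show "(\<lambda>b. R (G b)) \<in> mspace B \<rightarrow> mspace (submetric (linf n) Q)"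
        using R(1)[OF G(1)] Q by auto
      show "mdist (submetric (linf n) Q) (R (G b)) (R (G c)) \<le> mdist B b c"
        if "b \<in> mspace B" "c \<in> mspace B" for b c
        using R(2)[OF G(1) G(1), of b c] G(2)[OF that] by simp
    qed
    show "R (G a) = \<Phi> a" if "a \<in> A" for a
      using G(3)[OF that] R(3) \<Phi>[OF that] by simp
  qed
  show "\<exists>\<Psi>. one_Lipschitz_map B (submetric (linf n) Q) \<Psi> \<and> (\<forall>a\<in>A. \<Psi> a = \<Phi> a)"
  proof (cases "A = {}")
    case True
    \<comment> \<open>With \<open>A\<close> empty, any constant map into \<open>Q\<close> will do;
      this requires a point of \<open>Q\<close>.\<close>
    obtain q where "q \<in> Q" using Q by blast
    moreover have "linf_dist n q q = 0" by (simp add: linf_dist_def)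
    ultimately show ?thesis
      using Q True by (intro RI[of "\<lambda>_. q"]) auto
  next
    case False
    have "\<forall>i\<in>{1..n}. \<exists>F. (\<forall>a\<in>A. F a = \<Phi> a i) \<and>
      (\<forall>x\<in>mspace B. \<forall>y\<in>mspace B. \<bar>F x - F y\<bar> \<le> mdist B x y)"
    proof
      fix i assume i: "i \<in> {1..n}"
      have "\<bar>\<Phi> a i - \<Phi> b i\<bar> \<le> mdist B a b" if "a \<in> A" "b \<in> A" for a b
        using abs_coord_le_linf_dist[OF i] \<Phi>_Lip[OF that] by (rule order_trans)
      from real_Lipschitz_extension[OF A False this]
      obtain F where "\<And>a. a \<in> A \<Longrightarrow> F a = \<Phi> a i"
        "\<And>x y. \<lbrakk>x \<in> mspace B; y \<in> mspace B\<rbrakk> \<Longrightarrow> \<bar>F x - F y\<bar> \<le> mdist B x y"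
        by blast
      then show "\<exists>F. (\<forall>a\<in>A. F a = \<Phi> a i) \<and>
        (\<forall>x\<in>mspace B. \<forall>y\<in>mspace B. \<bar>F x - F y\<bar> \<le> mdist B x y)" by blast
    qed
    from bchoice[OF this] obtain F where
      F: "\<And>i a. \<lbrakk>i \<in> {1..n}; a \<in> A\<rbrakk> \<Longrightarrow> F i a = \<Phi> a i"
        "\<And>i x y. \<lbrakk>i \<in> {1..n}; x \<in> mspace B; y \<in> mspace B\<rbrakk> \<Longrightarrow> \<bar>F i x - F i y\<bar> \<le> mdist B x y"
      by blast
    show ?thesis
    proof (rule RI[of "\<lambda>b. \<lambda>i\<in>{1..n}. F i b"])
      show "linf_dist n (\<lambda>i\<in>{1..n}. F i b) (\<lambda>i\<in>{1..n}. F i c) \<le> mdist B b c"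
        if "b \<in> mspace B" "c \<in> mspace B" for b c
        using F(2) that by (intro linf_dist_leI) auto
      show "(\<lambda>i\<in>{1..n}. F i a) = \<Phi> a" if a: "a \<in> A" for a
      proof -
        have "(\<lambda>i\<in>{1..n}. F i a) = (\<lambda>i\<in>{1..n}. \<Phi> a i)"
          using F(1) a by (intro restrict_ext) auto
        also have "\<dots> = \<Phi> a"
          using \<Phi>[OF a] Q by (intro PiE_restrict) blast
        finally show ?thesis .
      qed
    qed simp
  qed
qed

section \<open>Inequalities separating a retract from its complement\<close>

text \<open>The best 1-Lipschitz bounds on \<open>x\<^sub>i\<close> valid on \<open>Q\<close> are \<open>f y = (SUP q\<in>Q. q\<^sub>i - d q y)\<close> above and
  \<open>g y = (INF q\<in>Q. q\<^sub>i + d q y)\<close> below, but away from the projection of \<open>Q\<close> one may have \<open>f < g\<close>.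
  Replacing both by their mean where \<open>f < g\<close> restores the order and still excludes \<open>x\<close>:
  if \<open>x\<^sub>i < z\<^sub>i\<close>, say, then \<open>x\<^sub>i \<le> f\<close> and \<open>x\<^sub>i < (x\<^sub>i + z\<^sub>i) / 2 \<le> g\<close>.\<close>

definition separating_bounds ::
  "nat \<Rightarrow> (nat \<Rightarrow> real) set \<Rightarrow> nat \<Rightarrow> ((nat \<Rightarrow> real) \<Rightarrow> ereal) \<Rightarrow> ((nat \<Rightarrow> real) \<Rightarrow> ereal) \<Rightarrow> bool" where
  "separating_bounds n Q i lo up \<longleftrightarrow>
    bound_function (n - 1) (- \<infinity>) lo \<and> bound_function (n - 1) \<infinity> up \<and>
    (\<forall>y. lo y \<le> up y) \<and>
    (\<forall>x\<in>Q. lo (omit n i x) \<le> ereal (x i) \<and> ereal (x i) \<le> up (omit n i x)) \<and>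
    (\<forall>x. \<forall>z\<in>Q. (\<forall>q\<in>Q. linf_dist n z q \<le> linf_dist n x q) \<and>
      linf_dist n x z = \<bar>x i - z i\<bar> \<and> x i \<noteq> z i \<longrightarrow>
      ereal (x i) < lo (omit n i x) \<or> up (omit n i x) < ereal (x i))"

lemma ex_separating_bounds:
  assumes i: "i \<in> {1..n}" and Q: "Q \<noteq> {}"
  shows "\<exists>lo up. separating_bounds n Q i lo up"
proof -
  define d where "d q y = linf_dist (n - 1) (omit n i q) y" for q y
  define f where "f y = (SUP q\<in>Q. q i - d q y)" for y
  define g where "g y = (INF q\<in>Q. q i + d q y)" for y
  \<comment> \<open>By the shift lemmas, finiteness of the supremum or infimum at one
    \<open>y\<close> gives it at all \<open>y\<close>. So \<open>bf\<close> and \<open>bg\<close>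
    are global switches between a Lipschitz bound and an infinite constant.\<close>
  define bf where "bf \<longleftrightarrow> (\<forall>y. bdd_above ((\<lambda>q. q i - d q y) ` Q))"
  define bg where "bg \<longleftrightarrow> (\<forall>y. bdd_below ((\<lambda>q. q i + d q y) ` Q))"
  define up where "up y = (if bf then ereal (if bg then max (f y) ((f y + g y) / 2) else f y) else \<infinity>)"
    for y
  define lo where "lo y = (if bg then ereal (if bf then min (g y) ((f y + g y) / 2) else g y) else - \<infinity>)"
    for y
  have d_diff: "\<bar>d q y - d q y'\<bar> \<le> linf_dist (n - 1) y y'" for q y y'
    using linf_dist_triangle[of "n - 1" "omit n i q" y y'] linf_dist_triangle[of "n - 1" "omit n i q" y' y]
    by (simp add: d_def linf_dist_commute[of _ y' y] abs_le_iff)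
  have d_nonneg: "0 \<le> d q y" for q y
    by (simp add: d_def linf_dist_nonneg)
  have d0: "d q (omit n i q) = 0" for q
    by (simp add: d_def linf_dist_def)
  have dist: "linf_dist n x q = max \<bar>x i - q i\<bar> (d q (omit n i x))" for x q
    unfolding linf_dist_omit[OF i] d_def by (simp add: linf_dist_commute)
  have closer: "\<bar>z i - q i\<bar> \<le> \<bar>x i - q i\<bar> \<or> \<bar>z i - q i\<bar> \<le> d q (omit n i x)"
    if "linf_dist n z q \<le> linf_dist n x q" for x z q
    using order_trans[OF abs_coord_le_linf_dist[OF i] that] unfolding dist le_max_iff_disj .
  have far: "d z (omit n i x) \<le> \<bar>x i - z i\<bar>" if "linf_dist n x z = \<bar>x i - z i\<bar>" for x z
    using that unfolding dist by simp
  have bfI: bf if "bdd_above ((\<lambda>q. q i - d q y) ` Q)" for y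
    unfolding bf_def
  proof
    fix y'
    show "bdd_above ((\<lambda>q. q i - d q y') ` Q)"
      using that by (rule bdd_above_shift[where c = "linf_dist (n - 1) y y'"])
        (use d_diff[of _ y' y] in \<open>simp add: linf_dist_commute[of _ y' y]\<close>)
  qed
  have bgI: bg if "bdd_below ((\<lambda>q. q i + d q y) ` Q)" for y
    unfolding bg_def
  proof
    fix y'
    show "bdd_below ((\<lambda>q. q i + d q y') ` Q)"
      using that by (rule bdd_below_shift[where c = "linf_dist (n - 1) y y'"])
        (use d_diff[of _ y y'] in simp)
  qed
  have f_Lip: "\<bar>f y - f y'\<bar> \<le> linf_dist (n - 1) y y'" if bf for y y'
    unfolding f_def using Q that d_diff[of _ y' y]
    by (intro abs_SUP_diff_le) (auto simp: bf_def linf_dist_commute[of _ y' y])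
  have g_Lip: "\<bar>g y - g y'\<bar> \<le> linf_dist (n - 1) y y'" if bg for y y'
    unfolding g_def using Q that d_diff[of _ y y']
    by (intro abs_INF_diff_le) (auto simp: bg_def)
  have f_ge: "q i - d q y \<le> f y" if bf "q \<in> Q" for q y
    unfolding f_def using that by (intro cSUP_upper) (auto simp: bf_def)
  have g_le: "g y \<le> q i + d q y" if bg "q \<in> Q" for q y
    unfolding g_def using that by (intro cINF_lower) (auto simp: bg_def)
  have below: "ereal (x i) < lo (omit n i x)"
    if z: "z \<in> Q" "\<And>q. q \<in> Q \<Longrightarrow> linf_dist n z q \<le> linf_dist n x q"
      "linf_dist n x z = \<bar>x i - z i\<bar>" "x i < z i" for x z
  proof -
    let ?y = "omit n i x"
    \<comment> \<open>If \<open>q\<close> is at least as close to \<open>z\<close> as to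
      \<open>x\<close> in coordinate \<open>i\<close>, then \<open>q i\<close> lies on the
      \<open>z\<close> side of the midpoint. Otherwise \<open>d q ?y\<close> is at least
      \<open>\<bar>z i - q i\<bar>\<close>, whence \<open>q i + d q ?y\<close> is at least
      \<open>z i\<close>.\<close>
    have ge: "(x i + z i) / 2 \<le> q i + d q ?y" if "q \<in> Q" for q
      using closer[OF z(2)[OF that]] d_nonneg[of q ?y] z(4) by (auto simp: abs_if split: if_splits)
    then have bg: bg
      by (intro bgI[of ?y] bdd_belowI2)
    have g: "(x i + z i) / 2 \<le> g ?y"
      unfolding g_def using Q ge by (intro cINF_greatest)
    \<comment> \<open>The point \<open>z\<close> itself witnesses this: \<open>far\<close> gives
      \<open>d z ?y \<le> z i - x i\<close>, so \<open>z i - d z ?y\<close> is at least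
      \<open>x i\<close>. The mean of \<open>f ?y\<close> and \<open>g ?y\<close> then exceeds
      \<open>x i\<close> strictly.\<close>
    have "x i \<le> f ?y" if bf
      using f_ge[OF that z(1), of ?y] far[OF z(3)] z(4) by (simp add: abs_if)
    with bg g z(4) show ?thesis by (auto simp: lo_def)
  qed
  have above: "up (omit n i x) < ereal (x i)"
    if z: "z \<in> Q" "\<And>q. q \<in> Q \<Longrightarrow> linf_dist n z q \<le> linf_dist n x q"
      "linf_dist n x z = \<bar>x i - z i\<bar>" "z i < x i" for x z
  proof -
    let ?y = "omit n i x"
    have le: "q i - d q ?y \<le> (x i + z i) / 2" if "q \<in> Q" for q
      using closer[OF z(2)[OF that]] d_nonneg[of q ?y] z(4) by (auto simp: abs_if split: if_splits)
    then have bf: bf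
      by (intro bfI[of ?y] bdd_aboveI2)
    have f: "f ?y \<le> (x i + z i) / 2"
      unfolding f_def using Q le by (intro cSUP_least)
    have "g ?y \<le> x i" if bg
      using g_le[OF that z(1), of ?y] far[OF z(3)] z(4) by (simp add: abs_if)
    with bf f z(4) show ?thesis by (auto simp: up_def)
  qed
  have "bound_function (n - 1) (- \<infinity>) lo"
  proof (cases bg)
    case True
    have "\<bar>(if bf then min (g y) ((f y + g y) / 2) else g y) -
        (if bf then min (g y') ((f y' + g y') / 2) else g y')\<bar> \<le> linf_dist (n - 1) y y'" for y y'
      using f_Lip[of y y'] g_Lip[OF True, of y y'] by (cases bf) (auto simp: abs_le_iff min_def field_simps)
    then show ?thesis
      unfolding bound_function_def one_Lipschitz_map_def
      by (intro disjI1 exI[of _ "\<lambda>y. if bf then min (g y) ((f y + g y) / 2) else g y"])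
        (simp add: lo_def True dist_real_def)
  qed (simp add: bound_function_def lo_def)
  moreover have "bound_function (n - 1) \<infinity> up"
  proof (cases bf)
    case True
    have "\<bar>(if bg then max (f y) ((f y + g y) / 2) else f y) -
        (if bg then max (f y') ((f y' + g y') / 2) else f y')\<bar> \<le> linf_dist (n - 1) y y'" for y y'
      using f_Lip[OF True, of y y'] g_Lip[of y y'] by (cases bg) (auto simp: abs_le_iff max_def field_simps)
    then show ?thesis
      unfolding bound_function_def one_Lipschitz_map_def
      by (intro disjI1 exI[of _ "\<lambda>y. if bg then max (f y) ((f y + g y) / 2) else f y"])
        (simp add: up_def True dist_real_def)
  qed (simp add: bound_function_def up_def)
  \<comment> \<open>When both bounds are finite, the mean of \<open>f y\<close> and
    \<open>g y\<close> separates them; otherwise one of them is infinite.\<close>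
  moreover have "lo y \<le> up y" for y
    by (simp add: lo_def up_def min_le_iff_disj le_max_iff_disj)
  moreover have "lo (omit n i x) \<le> ereal (x i) \<and> ereal (x i) \<le> up (omit n i x)" if "x \<in> Q" for x
    using f_ge[OF _ that, of "omit n i x"] g_le[OF _ that, of "omit n i x"]
    by (auto simp: lo_def up_def d0 min_le_iff_disj le_max_iff_disj)
  moreover have "ereal (x i) < lo (omit n i x) \<or> up (omit n i x) < ereal (x i)"
    if "z \<in> Q" "\<forall>q\<in>Q. linf_dist n z q \<le> linf_dist n x q" "linf_dist n x z = \<bar>x i - z i\<bar>" "x i \<noteq> z i"
    for x z
    using below[of z x] above[of z x] that by (cases "x i < z i") auto
  ultimately show ?thesis
    unfolding separating_bounds_def by (intro exI[of _ lo] exI[of _ up]) blast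
qed

lemma Lipschitz_bounded_form_if_retract:
  assumes n: "n \<ge> 1" and Q: "Q \<subseteq> {1..n} \<rightarrow>\<^sub>E UNIV" "Q \<noteq> {}"
    and "linf_retraction n Q R"
  shows "Lipschitz_bounded_form n Q"
proof -
  note R = linf_retractionD[OF \<open>linf_retraction n Q R\<close>]
  have "\<forall>i\<in>{1..n}. \<exists>lo up. separating_bounds n Q i lo up"
    by (intro ballI ex_separating_bounds Q(2))
  then obtain lo up where "\<forall>i\<in>{1..n}. separating_bounds n Q i (lo i) (up i)"
    by metis
  note b = this[unfolded separating_bounds_def]
  have "x \<in> Q" if x: "x \<in> {1..n} \<rightarrow>\<^sub>E UNIV"
    and le: "\<forall>i\<in>{1..n}. lo i (omit n i x) \<le> ereal (x i) \<and> ereal (x i) \<le> up i (omit n i x)" for x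
  proof (rule ccontr)
    assume "x \<notin> Q"
    \<comment> \<open>As \<open>R\<close> is 1-Lipschitz and fixes each \<open>q\<close> in
      \<open>Q\<close>, its value \<open>z\<close> is no farther from \<open>q\<close> than
      \<open>x\<close> is. A coordinate realising the distance from \<open>x\<close> to
      \<open>z\<close> is one in which \<open>x\<close> violates a bound.\<close>
    define z where "z = R x"
    have z: "z \<in> Q" using R(1)[OF x] by (simp add: z_def)
    have zq: "\<forall>q\<in>Q. linf_dist n z q \<le> linf_dist n x q"
    proof
      show "linf_dist n z q \<le> linf_dist n x q" if "q \<in> Q" for q
        using R(2)[OF x, of q] R(3)[OF that] that Q(1) by (auto simp: z_def)
    qed
    obtain i where i: "i \<in> {1..n}" "linf_dist n x z = \<bar>x i - z i\<bar>"
      using linf_dist_attained[OF n] by blast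
    have "linf_dist n x z \<noteq> 0"
      using Metric_space.zero[OF Metric_space_linf x, of z] z Q(1) \<open>x \<notin> Q\<close> by blast
    then have "x i \<noteq> z i" using i(2) by simp
    then have "ereal (x i) < lo i (omit n i x) \<or> up i (omit n i x) < ereal (x i)"
      using bspec[OF b i(1)] z zq i(2) by blast
    then show False using bspec[OF le i(1)] by auto
  qed
  then have "Q = {x \<in> mspace (linf n). \<forall>i\<in>{1..n}.
      lo i (omit n i x) \<le> ereal (x i) \<and> ereal (x i) \<le> up i (omit n i x)}"
    using bspec[OF b] Q(1) unfolding mspace_linf by blast
  then show ?thesis
    unfolding Lipschitz_bounded_form_def using b
    by (intro exI[of _ lo] exI[of _ up] conjI) blast+
qed

text \<open>Extending the identity of \<open>Q\<close> to all of \<open>linf n\<close> is the only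
  instance of injectivity used, so the point type of \<open>linf n\<close> is the only one that
  matters here.\<close>

lemma injective_metric_retraction:
  assumes inj: "injective_metric TYPE(nat \<Rightarrow> real) (submetric (linf n) Q)"
    and Q: "Q \<subseteq> {1..n} \<rightarrow>\<^sub>E UNIV"
  shows "\<exists>R. linf_retraction n Q R"
proof -
  have "Q \<subseteq> mspace (linf n) \<and>
      one_Lipschitz_map (submetric (linf n) Q) (submetric (linf n) Q) (\<lambda>x. x)"
    using Q by (simp add: one_Lipschitz_map_def)
  then show ?thesis
    using inj[unfolded injective_metric_def, rule_format, of Q "linf n" "\<lambda>x. x"]
    unfolding linf_retraction_def by blast
qed

text \<open>Injectivity over all metric spaces is expressed in two pieces: testing it at the type
  \<open>nat \<Rightarrow> real\<close> already yields the inequalities, and the inequalities yield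
  it at an arbitrary type \<open>'b\<close>.\<close>

theorem proposition2p5:
  fixes n :: nat and Q :: "(nat \<Rightarrow> real) set"
  assumes "n \<ge> 1" and "Q \<subseteq> mspace (linf n)" and "Q \<noteq> {}"
  shows "(injective_metric TYPE(nat \<Rightarrow> real) (submetric (linf n) Q)
            \<longleftrightarrow> Lipschitz_bounded_form n Q)
       \<and> (Lipschitz_bounded_form n Q
            \<longrightarrow> injective_metric TYPE('b) (submetric (linf n) Q))"
proof -
  have Q: "Q \<subseteq> {1..n} \<rightarrow>\<^sub>E UNIV" using assms(2) by simp
  have "Lipschitz_bounded_form n Q" if "injective_metric TYPE(nat \<Rightarrow> real) (submetric (linf n) Q)"
    using injective_metric_retraction[OF that Q]
      Lipschitz_bounded_form_if_retract[OF assms(1) Q assms(3)] by blast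
  moreover have "injective_metric TYPE('b) (submetric (linf n) Q)"
      "injective_metric TYPE(nat \<Rightarrow> real) (submetric (linf n) Q)"
    if "Lipschitz_bounded_form n Q"
    using Lipschitz_bounded_form_retraction[OF that assms(3)]
      injective_metric_retract[OF Q assms(3)] by blast+
  ultimately show ?thesis by blast
qed

end
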